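(* Let $G$ be a finite Abelian group, written multiplicatively, with elements $g_0,\dots,g_{\ell-1}$. Let $p$ be a probability distribution on $G$, and let ${\cal P}$ be the $\ell\times\ell$ doubly stochastic matrix with elements ${\cal P}_{ab}=p(g_a^{-1}g_b)$. Let $q^{(0)}$ be a probability (row) vector with $\ell$ components, and for $n=0,1,2,\dots$ let $q^{(n)}=q^{(0)}{\cal P}^n$ be the probability vector at time $n$ of the random walk on $G$ with transition matrix ${\cal P}$. Then: (1) For every $k\ge 0$, all probability vectors $q^{(n)}$ with $n\ge k$ belong to the polytope ${\cal A}[q^{(k)};{\cal B}(G)]$, which depends only on $q^{(k)}$ (and $G$) and does not depend on the transition matrix ${\cal P}$. (2) During time evolution: (a) the probability vectors are ordered by majorization: $q^{(0)}\succ q^{(1)}\succ q^{(2)}\succ\cdots$; (b) the entropy increases: $E[q^{(0)}]\le E[q^{(1)}]\le E[q^{(2)}]\le\cdots$; (c) the Gini index decreases: ${\cal G}[q^{(0)}]\ge {\cal G}[q^{(1)}]\ge{\cal G}[q^{(2)}]\ge\cdots$; (d) the polytopes of the probability vectors shrink: ${\cal A}[q^{(0)};{\cal B}(G)]\supseteq{\cal A}[q^{(1)};{\cal B}(G)]\supseteq{\cal A}[q^{(2)};{\cal B}(G)]\supseteq\cdots$.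
   Context: Probability vectors are row vectors ${\bf x}=(x_0,\dots,x_{\ell-1})$ with $x_a\ge 0$ and $\sum_a x_a=1$; matrices act on them from the right. For $r\in\{0,\dots,\ell-1\}$ let $M(r)$ be the $\ell\times\ell$ permutation matrix whose $(a,b)$ element is $1$ if $g_a^{-1}g_b=g_r$ and $0$ otherwise; these matrices form a group isomorphic to $G$. The Birkhoff subpolytope ${\cal B}(G)$ is the set of all convex combinations $\sum_{r=0}^{\ell-1}\lambda_r M(r)$ with $\lambda_r\ge 0$, $\sum_r\lambda_r=1$. The polytope of a probability vector ${\bf x}$ with respect to ${\cal B}(G)$ is ${\cal A}[{\bf x};{\cal B}(G)]=\{{\bf x}{\cal Q}\,:\,{\cal Q}\in{\cal B}(G)\}$. (A probability vector may be represented by its first $\ell-1$ components as a point of $[0,1]^{\ell-1}$, since the last component is determined by the others.) Lorenz values: for a probability vector ${\bf x}$ let $\pi$ be a permutation with $x_{\pi(0)}\le x_{\pi(1)}\le\cdots\le x_{\pi(\ell-1)}$, and set ${\cal L}(a;{\bf x})=x_{\pi(0)}+\cdots+x_{\pi(a)}$ for $a=0,\dots,\ell-1$. Majorization: ${\bf x}\succ{\bf y}$ means ${\cal L}(a;{\bf x})\le{\cal L}(a;{\bf y})$ for all $a$. Entropy: $E({\bf x})=-\sum_a x_a\log x_a$ (with $0\log 0=0$). Gini index: ${\cal G}({\bf x})=1-\frac{2}{\ell+1}\sum_{a=0}^{\ell-1}{\cal L}(a;{\bf x})=\frac{1}{2(\ell+1)}\sum_{a,b}|x_a-x_b|$. 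*)

theory Defs
  imports Complex_Main "HOL-Algebra.Coset" "Jordan_Normal_Form.Matrix" "HOL-Combinatorics.List_Permutation"
begin

(* Throughout, g :: nat => 'a enumerates the carrier of the finite group G with
   indices 0, ..., order G - 1; this is assumed where it is needed. *)

definition prob_vec :: "nat \<Rightarrow> real vec \<Rightarrow> bool" where
  "prob_vec l x \<longleftrightarrow> x \<in> carrier_vec l \<and> (\<forall>a<l. 0 \<le> x $ a) \<and> (\<Sum>a<l. x $ a) = 1"

(* The row vector x times A; the entry sequences of row and column vectors
   share the type "real vec", so "A *\<^sub>v x" is the action from the other side. *)
definition vec_mult_mat :: "real vec \<Rightarrow> real mat \<Rightarrow> real vec" (infixl "\<^sub>v*" 70) where
  "x \<^sub>v* A = vec (dim_col A) (\<lambda>b. x \<bullet> col A b)"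

definition doubly_stochastic :: "nat \<Rightarrow> real mat \<Rightarrow> bool" where
  "doubly_stochastic l A \<longleftrightarrow> A \<in> carrier_mat l l \<and> (\<forall>a<l. \<forall>b<l. 0 \<le> A $$ (a, b)) \<and>
     (\<forall>a<l. (\<Sum>b<l. A $$ (a, b)) = 1) \<and> (\<forall>b<l. (\<Sum>a<l. A $$ (a, b)) = 1)"

definition transition_mat :: "('a, 'c) monoid_scheme \<Rightarrow> (nat \<Rightarrow> 'a) \<Rightarrow> ('a \<Rightarrow> real) \<Rightarrow> real mat" where
  "transition_mat G g p =
     mat (order G) (order G) (\<lambda>(a, b). p (inv\<^bsub>G\<^esub> (g a) \<otimes>\<^bsub>G\<^esub> g b))"

definition group_perm_mat :: "('a, 'c) monoid_scheme \<Rightarrow> (nat \<Rightarrow> 'a) \<Rightarrow> nat \<Rightarrow> real mat" where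
  "group_perm_mat G g r =
     mat (order G) (order G) (\<lambda>(a, b). if inv\<^bsub>G\<^esub> (g a) \<otimes>\<^bsub>G\<^esub> g b = g r then 1 else 0)"

definition birkhoff_subpolytope :: "('a, 'c) monoid_scheme \<Rightarrow> (nat \<Rightarrow> 'a) \<Rightarrow> real mat set" where
  "birkhoff_subpolytope G g =
     {mat (order G) (order G) (\<lambda>(a, b). \<Sum>r<order G. \<mu> r * group_perm_mat G g r $$ (a, b)) | \<mu>.
        (\<forall>r<order G. 0 \<le> \<mu> r) \<and> (\<Sum>r<order G. \<mu> r) = 1}"

definition vec_polytope :: "real vec \<Rightarrow> real mat set \<Rightarrow> real vec set" where
  "vec_polytope x B = {x \<^sub>v* Q | Q. Q \<in> B}"

definition lorenz :: "nat \<Rightarrow> real vec \<Rightarrow> real" where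
  "lorenz a x = (\<Sum>i\<le>a. sort (list_of_vec x) ! i)"

(* x majorizes y: with partial sums of the increasingly sorted entries, the
   majorizing vector has the smaller sums. *)
definition majorizes :: "real vec \<Rightarrow> real vec \<Rightarrow> bool" (infix "\<succ>\<^sub>m" 50) where
  "x \<succ>\<^sub>m y \<longleftrightarrow> dim_vec x = dim_vec y \<and> (\<forall>a<dim_vec x. lorenz a x \<le> lorenz a y)"

(* 0 * ln 0 = 0 holds because of the factor 0. *)
definition vec_entropy :: "real vec \<Rightarrow> real" where
  "vec_entropy x = - (\<Sum>a<dim_vec x. x $ a * ln (x $ a))"

definition gini :: "real vec \<Rightarrow> real" where
  "gini x = 1 - 2 / (real (dim_vec x) + 1) * (\<Sum>a<dim_vec x. lorenz a x)"

(* The Lorenz values may be computed with any permutation that sorts the entries. *)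
lemma lorenz_permutes:
  assumes \<pi>: "\<pi> permutes {..<dim_vec x}"
    and sorted: "\<And>i j. i \<le> j \<Longrightarrow> j < dim_vec x \<Longrightarrow> x $ \<pi> i \<le> x $ \<pi> j"
    and a: "a < dim_vec x"
  shows "lorenz a x = (\<Sum>i\<le>a. x $ \<pi> i)"
proof -
  have len: "length (list_of_vec x) = dim_vec x" by simp
  have nth: "list_of_vec x ! i = x $ i" for i by (simp add: list_of_vec_index)
  let ?ys = "permute_list \<pi> (list_of_vec x)"
  have p: "\<pi> permutes {..<length (list_of_vec x)}" using \<pi> by simp
  have y: "?ys ! i = x $ \<pi> i" if "i < dim_vec x" for i
    using permute_list_nth[OF p] that by (simp add: nth)
  have ly: "length ?ys = dim_vec x" by simp
  have "sorted ?ys"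
    unfolding sorted_iff_nth_mono ly using sorted y by auto
  moreover have "mset ?ys = mset (list_of_vec x)" using p by simp
  ultimately have "sort (list_of_vec x) = ?ys" using properties_for_sort by metis
  then show ?thesis unfolding lorenz_def using y a by (auto intro!: sum.cong)
qed

lemma transition_mat_doubly_stochastic:
  assumes G: "group G" and fin: "finite (carrier G)"
    and g: "bij_betw g {..<order G} (carrier G)"
    and p0: "\<And>h. h \<in> carrier G \<Longrightarrow> 0 \<le> p h" and p1: "(\<Sum>h\<in>carrier G. p h) = 1"
  shows "doubly_stochastic (order G) (transition_mat G g p)"
proof -
  interpret group G by fact
  have gc: "g a \<in> carrier G" if "a < order G" for a
    using g that by (auto simp: bij_betw_def)
  have r: "(\<Sum>b<order G. p (inv\<^bsub>G\<^esub> (g a) \<otimes>\<^bsub>G\<^esub> g b)) = 1" if a: "a < order G" for a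
  proof -
    have "(\<Sum>b<order G. p (inv\<^bsub>G\<^esub> (g a) \<otimes>\<^bsub>G\<^esub> g b)) = (\<Sum>h\<in>carrier G. p (inv\<^bsub>G\<^esub> (g a) \<otimes>\<^bsub>G\<^esub> h))"
      by (rule sum.reindex_bij_betw[OF g])
    also have "\<dots> = (\<Sum>h\<in>carrier G. p h)"
      by (rule sum.reindex_bij_witness[of _ "\<lambda>h. g a \<otimes>\<^bsub>G\<^esub> h" "\<lambda>h. inv\<^bsub>G\<^esub> (g a) \<otimes>\<^bsub>G\<^esub> h"])
        (use gc[OF a] in \<open>auto simp: m_assoc[symmetric]\<close>)
    finally show ?thesis using p1 by simp
  qed
  have c: "(\<Sum>a<order G. p (inv\<^bsub>G\<^esub> (g a) \<otimes>\<^bsub>G\<^esub> g b)) = 1" if b: "b < order G" for b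
  proof -
    have "(\<Sum>a<order G. p (inv\<^bsub>G\<^esub> (g a) \<otimes>\<^bsub>G\<^esub> g b)) = (\<Sum>h\<in>carrier G. p (inv\<^bsub>G\<^esub> h \<otimes>\<^bsub>G\<^esub> g b))"
      by (rule sum.reindex_bij_betw[OF g])
    also have "\<dots> = (\<Sum>h\<in>carrier G. p h)"
      by (rule sum.reindex_bij_witness[of _ "\<lambda>h. g b \<otimes>\<^bsub>G\<^esub> inv\<^bsub>G\<^esub> h" "\<lambda>h. inv\<^bsub>G\<^esub> h \<otimes>\<^bsub>G\<^esub> g b"])
        (use gc[OF b] in \<open>auto simp: m_assoc inv_mult_group m_assoc[symmetric]\<close>)
    finally show ?thesis using p1 by simp
  qed
  show ?thesis
    unfolding doubly_stochastic_def transition_mat_def using r c p0 gc by simp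
qed

lemma prob_vec_mult:
  assumes x: "prob_vec l x" and A: "doubly_stochastic l A"
  shows "prob_vec l (x \<^sub>v* A)"
proof -
  have e: "(x \<^sub>v* A) $ b = (\<Sum>a<l. x $ a * A $$ (a, b))" if "b < l" for b
    using x A that unfolding prob_vec_def doubly_stochastic_def vec_mult_mat_def
    by (auto simp: scalar_prod_def lessThan_atLeast0 intro!: sum.cong)
  have "(\<Sum>b<l. (x \<^sub>v* A) $ b) = (\<Sum>b<l. \<Sum>a<l. x $ a * A $$ (a, b))" using e by simp
  also have "\<dots> = (\<Sum>a<l. x $ a * (\<Sum>b<l. A $$ (a, b)))"
    by (subst sum.swap) (simp add: sum_distrib_left)
  also have "\<dots> = 1" using x A unfolding prob_vec_def doubly_stochastic_def by simp
  finally have s: "(\<Sum>b<l. (x \<^sub>v* A) $ b) = 1" .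
  have "x \<^sub>v* A \<in> carrier_vec l"
    using A unfolding doubly_stochastic_def vec_mult_mat_def by auto
  moreover have "\<forall>b<l. 0 \<le> (x \<^sub>v* A) $ b"
    using e x A unfolding prob_vec_def doubly_stochastic_def by (auto intro!: sum_nonneg)
  ultimately show ?thesis using s unfolding prob_vec_def by blast
qed

end

theory Submission
  imports Defs
begin

text \<open>Convolution of distributions on the group is multiplication of transition matrices, and
  the Birkhoff subpolytope is exactly the set of all transition matrices; so it is a monoid
  containing every power of \<open>P\<close>, which gives the statements about polytopes. Majorization and
  entropy only use that \<open>P\<close> is doubly stochastic: a sum of \<open>a + 1\<close> entries of \<open>x P\<close> is a weighted
  sum of entries of \<open>x\<close> with weights in \<open>[0, 1]\<close> of total \<open>a + 1\<close>, and \<open>t ln t\<close> lies above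
  its tangents.\<close>

section \<open>Doubly stochastic matrices\<close>

lemma vec_mult_mat_carrier [simp]:
  "A \<in> carrier_mat n m \<Longrightarrow> x \<^sub>v* A \<in> carrier_vec m"
  by (auto simp: vec_mult_mat_def)

lemma vec_mult_mat_index:
  assumes "x \<in> carrier_vec n" "A \<in> carrier_mat n m" "b < m"
  shows "(x \<^sub>v* A) $ b = (\<Sum>a<n. x $ a * A $$ (a, b))"
  using assms by (auto simp: vec_mult_mat_def scalar_prod_def lessThan_atLeast0 intro!: sum.cong)

text \<open>Trades the row action for the column action of the transpose, so that its associativity
  can be read off from that of \<open>*\<^sub>v\<close>.\<close>

lemma vec_mult_mat_eq_transpose:
  assumes "x \<in> carrier_vec n" "A \<in> carrier_mat n m"
  shows "x \<^sub>v* A = A\<^sup>T *\<^sub>v x"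
  using assms
  by (intro eq_vecI) (auto simp: vec_mult_mat_def intro!: comm_scalar_prod[of _ n])

lemma vec_mult_mat_assoc:
  assumes "x \<in> carrier_vec n" "A \<in> carrier_mat n m" "B \<in> carrier_mat m k"
  shows "x \<^sub>v* (A * B) = x \<^sub>v* A \<^sub>v* B"
proof -
  have "x \<^sub>v* (A * B) = (B\<^sup>T * A\<^sup>T) *\<^sub>v x"
    using assms vec_mult_mat_eq_transpose[of x n "A * B" k] by (simp add: transpose_mult)
  also have "\<dots> = B\<^sup>T *\<^sub>v (A\<^sup>T *\<^sub>v x)"
    using assms by (intro assoc_mult_mat_vec[of _ k m _ n]) auto
  also have "\<dots> = x \<^sub>v* A \<^sub>v* B"
    using assms vec_mult_mat_eq_transpose[of "x \<^sub>v* A" m B k] vec_mult_mat_eq_transpose[of x n A m]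
    by simp
  finally show ?thesis .
qed

section \<open>Lorenz values, majorization and the Gini index\<close>

lemma exists_sorting_permutation:
  obtains \<pi> where "\<pi> permutes {..<dim_vec x}"
    and "\<And>i j. i \<le> j \<Longrightarrow> j < dim_vec x \<Longrightarrow> x $ \<pi> i \<le> (x $ \<pi> j :: real)"
proof -
  let ?xs = "list_of_vec x"
  obtain \<pi> where \<pi>: "\<pi> permutes {..<length ?xs}" "permute_list \<pi> ?xs = sort ?xs"
    using mset_eq_permutation[of "sort ?xs" ?xs] by (metis mset_sort)
  have nth: "sort ?xs ! i = x $ \<pi> i" if "i < dim_vec x" for i
    using that permute_list_nth[OF \<pi>(1)] \<pi>(2) by (simp add: list_of_vec_index)
  show thesis
  proof (rule that)
    show "\<pi> permutes {..<dim_vec x}"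
      using \<pi>(1) by simp
    show "x $ \<pi> i \<le> x $ \<pi> j" if "i \<le> j" "j < dim_vec x" for i j
      using sorted_nth_mono[OF sorted_sort[of ?xs] that(1)] that nth by simp
  qed
qed

text \<open>The smallest weighted sum under these constraints puts full weight on the
  \<open>a + 1\<close> smallest entries. Compare \<open>w\<close> with that extreme weight
  \<open>e\<close>: below the threshold \<open>t\<close> the difference \<open>w - e\<close> is
  nonpositive, above it nonnegative, so its product with \<open>x - t\<close> is never
  negative.\<close>

lemma lorenz_le_weighted_sum:
  assumes a: "a < dim_vec x"
    and w0: "\<And>b. b < dim_vec x \<Longrightarrow> 0 \<le> w b" and w1: "\<And>b. b < dim_vec x \<Longrightarrow> w b \<le> 1"
    and sum_w: "(\<Sum>b<dim_vec x. w b) = real (Suc a)"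
  shows "lorenz a x \<le> (\<Sum>b<dim_vec x. w b * x $ b)"
proof -
  let ?l = "dim_vec x"
  obtain \<pi> where \<pi>: "\<pi> permutes {..<?l}"
    and sorted: "\<And>i j. i \<le> j \<Longrightarrow> j < ?l \<Longrightarrow> x $ \<pi> i \<le> x $ \<pi> j"
    using exists_sorting_permutation[of x] by blast
  define t where "t = x $ \<pi> a"
  define e where "e i = (if i \<le> a then 1 else 0 :: real)" for i
  have sum_e: "(\<Sum>i<?l. e i * f i) = (\<Sum>i\<le>a. f i)" for f
    using a unfolding e_def by (intro sum.mono_neutral_cong_right) auto
  have \<pi>_less: "\<pi> i < ?l" if "i < ?l" for i
    using permutes_in_image[OF \<pi>, of i] that by simp
  have reindex: "(\<Sum>b<?l. f b) = (\<Sum>i<?l. f (\<pi> i))" for f :: "nat \<Rightarrow> real"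
    using sum.permute[OF \<pi>, of f] by simp
  have "0 \<le> (\<Sum>i<?l. (w (\<pi> i) - e i) * (x $ \<pi> i - t))"
  proof (rule sum_nonneg)
    fix i assume "i \<in> {..<?l}"
    then have i: "i < ?l" by simp
    show "0 \<le> (w (\<pi> i) - e i) * (x $ \<pi> i - t)"
    proof (cases "i \<le> a")
      case True
      then show ?thesis
        using w1[OF \<pi>_less[OF i]] sorted[OF True a]
        by (auto simp: e_def t_def intro: mult_nonpos_nonpos)
    next
      case False
      then show ?thesis
        using w0[OF \<pi>_less[OF i]] sorted[of a i] i by (auto simp: e_def t_def)
    qed
  qed
  \<comment> \<open>The coefficient of \<open>t\<close> is the difference of the two total weights,
    both \<open>a + 1\<close>, so the threshold drops out. The factor \<open>1\<close> lets
    \<open>sum_e\<close> apply to the total of \<open>e\<close>.\<close>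
  also have "\<dots> = (\<Sum>i<?l. w (\<pi> i) * x $ \<pi> i) - (\<Sum>i<?l. e i * x $ \<pi> i)
      - ((\<Sum>i<?l. w (\<pi> i)) - (\<Sum>i<?l. e i * 1)) * t"
    by (simp add: algebra_simps sum.distrib sum_subtractf sum_distrib_left)
  also have "\<dots> = (\<Sum>b<?l. w b * x $ b) - lorenz a x"
    using sum_w lorenz_permutes[OF \<pi> sorted a] reindex[of w] reindex[of "\<lambda>b. w b * x $ b"]
    unfolding sum_e by simp
  finally show ?thesis by simp
qed

lemma doubly_stochastic_majorizes:
  assumes x: "x \<in> carrier_vec l" and A: "doubly_stochastic l A"
  shows "x \<succ>\<^sub>m x \<^sub>v* A"
proof -
  have Ac: "A \<in> carrier_mat l l" and A0: "\<And>a b. a < l \<Longrightarrow> b < l \<Longrightarrow> 0 \<le> A $$ (a, b)"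
    and row: "\<And>a. a < l \<Longrightarrow> (\<Sum>b<l. A $$ (a, b)) = 1"
    and col: "\<And>b. b < l \<Longrightarrow> (\<Sum>a<l. A $$ (a, b)) = 1"
    using A unfolding doubly_stochastic_def by auto
  have dx: "dim_vec x = l" and dy: "dim_vec (x \<^sub>v* A) = l"
    using x vec_mult_mat_carrier[OF Ac, of x] by auto
  have "lorenz a x \<le> lorenz a (x \<^sub>v* A)" if a: "a < l" for a
  proof -
    obtain \<sigma> where \<sigma>: "\<sigma> permutes {..<l}"
      and sorted: "\<And>i j. i \<le> j \<Longrightarrow> j < l \<Longrightarrow> (x \<^sub>v* A) $ \<sigma> i \<le> (x \<^sub>v* A) $ \<sigma> j"
      using exists_sorting_permutation[of "x \<^sub>v* A"] unfolding dy by blast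
    have \<sigma>_less: "\<sigma> i < l" if "i < l" for i
      using permutes_in_image[OF \<sigma>, of i] that by simp
    \<comment> \<open>The share of entry \<open>b\<close> of \<open>x\<close> that is sent to the
      \<open>a + 1\<close> smallest entries of the image. Row sums will bound it by 1, and column
      sums will give the total \<open>a + 1\<close>.\<close>
    define w where "w b = (\<Sum>i\<le>a. A $$ (b, \<sigma> i))" for b
    have "lorenz a (x \<^sub>v* A) = (\<Sum>i\<le>a. \<Sum>b<l. x $ b * A $$ (b, \<sigma> i))"
      using lorenz_permutes[of \<sigma> "x \<^sub>v* A" a] \<sigma> sorted a \<sigma>_less
      by (simp add: dy vec_mult_mat_index[OF x Ac])
    also have "\<dots> = (\<Sum>b<dim_vec x. w b * x $ b)"
      unfolding w_def dx by (subst sum.swap) (simp add: sum_distrib_left mult.commute)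
    also have "\<dots> \<ge> lorenz a x"
    proof (rule lorenz_le_weighted_sum; (unfold dx)?)
      show "a < l" by fact
      show "0 \<le> w b" if "b < l" for b
        using that a \<sigma>_less A0 by (auto simp: w_def intro!: sum_nonneg)
      show "w b \<le> 1" if b: "b < l" for b
      proof -
        have "w b \<le> (\<Sum>i<l. A $$ (b, \<sigma> i))"
          unfolding w_def using a b \<sigma>_less A0 by (intro sum_mono2) auto
        also have "\<dots> = (\<Sum>c<l. A $$ (b, c))"
          using sum.permute[OF \<sigma>, of "\<lambda>c. A $$ (b, c)"] by simp
        finally show ?thesis using row[OF b] by simp
      qed
      show "(\<Sum>b<l. w b) = real (Suc a)"
        unfolding w_def using a \<sigma>_less col by (subst sum.swap) simp
    qed
    finally show ?thesis .
  qed
  then show ?thesis unfolding majorizes_def dx dy by simp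
qed

text \<open>The Gini index is a decreasing affine function of the sum of all Lorenz values.\<close>

lemma majorizes_imp_gini_le:
  assumes "x \<succ>\<^sub>m y"
  shows "gini y \<le> gini x"
proof -
  have dim: "dim_vec y = dim_vec x" and le: "\<And>a. a < dim_vec x \<Longrightarrow> lorenz a x \<le> lorenz a y"
    using assms unfolding majorizes_def by auto
  have "(\<Sum>a<dim_vec x. lorenz a x) \<le> (\<Sum>a<dim_vec x. lorenz a y)"
    using le by (intro sum_mono) auto
  then have "2 / (real (dim_vec x) + 1) * (\<Sum>a<dim_vec x. lorenz a x)
      \<le> 2 / (real (dim_vec x) + 1) * (\<Sum>a<dim_vec x. lorenz a y)"
    by (rule mult_left_mono) simp
  then show ?thesis unfolding gini_def dim by simp
qed

section \<open>Entropy\<close>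

lemma xlnx_above_tangent:
  fixes x y :: real
  assumes "0 \<le> x" "0 < y"
  shows "x * ln y + x - y \<le> x * ln x"
proof (cases "x = 0")
  case False
  with assms have x: "0 < x" by simp
  \<comment> \<open>This is \<open>ln z \<le> z - 1\<close> at \<open>z = y / x\<close>, multiplied
    by \<open>x\<close>.\<close>
  have "x * (ln y - ln x) \<le> x * (y / x - 1)"
    using x assms ln_le_minus_one[of "y / x"] by (intro mult_left_mono) (auto simp: ln_div)
  then show ?thesis using x by (simp add: algebra_simps)
qed (use assms in simp)

text \<open>Jensen's inequality for \<open>t ln t\<close>: column \<open>b\<close> of
  \<open>A\<close> consists of weights under which the entries of \<open>x\<close> average to
  \<open>y $ b\<close>. Averaging the tangent at \<open>y $ b\<close> leaves
  \<open>y $ b * ln (y $ b)\<close>, since its linear part vanishes at the mean.\<close>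

lemma doubly_stochastic_entropy_le:
  assumes x: "x \<in> carrier_vec l" and x0: "\<And>a. a < l \<Longrightarrow> 0 \<le> x $ a" and A: "doubly_stochastic l A"
  shows "vec_entropy x \<le> vec_entropy (x \<^sub>v* A)"
proof -
  define y where "y = x \<^sub>v* A"
  have Ac: "A \<in> carrier_mat l l" and A0: "\<And>a b. a < l \<Longrightarrow> b < l \<Longrightarrow> 0 \<le> A $$ (a, b)"
    and row: "\<And>a. a < l \<Longrightarrow> (\<Sum>b<l. A $$ (a, b)) = 1"
    and col: "\<And>b. b < l \<Longrightarrow> (\<Sum>a<l. A $$ (a, b)) = 1"
    using A unfolding doubly_stochastic_def by auto
  have dx: "dim_vec x = l" and dy: "dim_vec y = l"
    using x vec_mult_mat_carrier[OF Ac, of x] by (auto simp: y_def)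
  have y: "y $ b = (\<Sum>a<l. x $ a * A $$ (a, b))" if "b < l" for b
    unfolding y_def by (rule vec_mult_mat_index[OF x Ac that])
  have "y $ b * ln (y $ b) \<le> (\<Sum>a<l. A $$ (a, b) * (x $ a * ln (x $ a)))" if b: "b < l" for b
  proof -
    have "A $$ (a, b) * (x $ a * ln (y $ b) + x $ a - y $ b)
        \<le> A $$ (a, b) * (x $ a * ln (x $ a))" if a: "a < l" for a
    \<comment> \<open>There is no tangent at 0. But a vanishing sum of nonnegative terms forces
      every \<open>x $ a * A $$ (a, b)\<close> to be 0, so both sides are 0 whatever the logarithms
      are.\<close>
    proof (cases "y $ b = 0")
      case True
      then have "x $ a * A $$ (a, b) = 0"
        using a b x0 A0 y[OF b] sum_nonneg_eq_0_iff[of "{..<l}" "\<lambda>a. x $ a * A $$ (a, b)"]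
        by auto
      with True show ?thesis by auto
    next
      case False
      have "0 \<le> y $ b"
        using b x0 A0 y[OF b] by (auto intro!: sum_nonneg)
      with False show ?thesis
        using xlnx_above_tangent[OF x0[OF a], of "y $ b"] A0[OF a b]
        by (intro mult_left_mono) auto
    qed
    then have "(\<Sum>a<l. A $$ (a, b) * (x $ a * ln (y $ b) + x $ a - y $ b))
        \<le> (\<Sum>a<l. A $$ (a, b) * (x $ a * ln (x $ a)))"
      by (intro sum_mono) auto
    also have "(\<Sum>a<l. A $$ (a, b) * (x $ a * ln (y $ b) + x $ a - y $ b))
        = (\<Sum>a<l. x $ a * A $$ (a, b)) * ln (y $ b) + (\<Sum>a<l. x $ a * A $$ (a, b))
          - (\<Sum>a<l. A $$ (a, b)) * y $ b"
      by (simp add: sum_distrib_right sum_distrib_left sum.distrib sum_subtractf algebra_simps)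
    finally show ?thesis using col[OF b] y[OF b] by simp
  qed
  then have "(\<Sum>b<l. y $ b * ln (y $ b)) \<le> (\<Sum>b<l. \<Sum>a<l. A $$ (a, b) * (x $ a * ln (x $ a)))"
    by (intro sum_mono) auto
  \<comment> \<open>Column sums made the averages above; after the exchange of sums the row sums
    remove \<open>A\<close>.\<close>
  also have "\<dots> = (\<Sum>a<l. (\<Sum>b<l. A $$ (a, b)) * (x $ a * ln (x $ a)))"
    by (subst sum.swap) (simp add: sum_distrib_right)
  also have "\<dots> = (\<Sum>a<l. x $ a * ln (x $ a))"
    using row by simp
  finally show ?thesis unfolding vec_entropy_def dx dy y_def[symmetric] by simp
qed

section \<open>The Birkhoff subpolytope of a group\<close>

definition distribution_on :: "'a set \<Rightarrow> ('a \<Rightarrow> real) \<Rightarrow> bool" where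
  "distribution_on S p \<longleftrightarrow> (\<forall>h\<in>S. 0 \<le> p h) \<and> (\<Sum>h\<in>S. p h) = 1"

locale enumerated_group = group G for G (structure) +
  fixes g :: "nat \<Rightarrow> 'a"
  assumes finite_carrier: "finite (carrier G)"
    and enum: "bij_betw g {..<order G} (carrier G)"
begin

lemma enum_closed [simp]: "a < order G \<Longrightarrow> g a \<in> carrier G"
  using enum by (auto simp: bij_betw_def)

lemma transition_mat_carrier [simp]:
  "transition_mat G g p \<in> carrier_mat (order G) (order G)"
  by (simp add: transition_mat_def)

text \<open>Exactly one \<open>r\<close> satisfies \<open>inv (g a) \<otimes> g b = g r\<close>, so
  entry \<open>(a, b)\<close> of a convex combination is a single coefficient. Coefficients and
  distributions are thus the same data, transported along the enumeration.\<close>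

lemma birkhoff_subpolytope_eq_transition_mats:
  "birkhoff_subpolytope G g = {transition_mat G g p | p. distribution_on (carrier G) p}"
proof -
  have *: "mat (order G) (order G) (\<lambda>(a, b). \<Sum>r<order G. p (g r) * group_perm_mat G g r $$ (a, b))
      = transition_mat G g p" for p
  proof (rule eq_matI)
    fix a b
    assume "a < dim_row (transition_mat G g p)" "b < dim_col (transition_mat G g p)"
    then have ab: "a < order G" "b < order G" by (auto simp: transition_mat_def)
    have "(\<Sum>r<order G. p (g r) * group_perm_mat G g r $$ (a, b))
        = (\<Sum>r<order G. p (g r) * (if inv (g a) \<otimes> g b = g r then 1 else 0))"
      using ab by (simp add: group_perm_mat_def)
    also have "\<dots> = (\<Sum>h\<in>carrier G. p h * (if inv (g a) \<otimes> g b = h then 1 else 0))"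
      by (rule sum.reindex_bij_betw[OF enum])
    also have "\<dots> = p (inv (g a) \<otimes> g b)"
      using ab finite_carrier by (simp add: if_distrib cong: if_cong)
    finally show "mat (order G) (order G)
        (\<lambda>(a, b). \<Sum>r<order G. p (g r) * group_perm_mat G g r $$ (a, b)) $$ (a, b)
      = transition_mat G g p $$ (a, b)"
      using ab by (simp add: transition_mat_def)
  qed (auto simp: transition_mat_def)
  have dist: "distribution_on (carrier G) p
      \<longleftrightarrow> (\<forall>r<order G. 0 \<le> p (g r)) \<and> (\<Sum>r<order G. p (g r)) = 1" for p
    using sum.reindex_bij_betw[OF enum, of p] bij_betw_imp_surj_on[OF enum, symmetric]
    by (simp add: distribution_on_def Ball_def[symmetric] flip: lessThan_iff)
  show ?thesis
  proof (intro equalityI subsetI)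
    fix Q assume "Q \<in> birkhoff_subpolytope G g"
    then obtain \<mu> where \<mu>: "\<forall>r<order G. 0 \<le> \<mu> r" "(\<Sum>r<order G. \<mu> r) = 1"
      and Q: "Q = mat (order G) (order G)
        (\<lambda>(a, b). \<Sum>r<order G. \<mu> r * group_perm_mat G g r $$ (a, b))"
      unfolding birkhoff_subpolytope_def by blast
    \<comment> \<open>The coefficients pulled back to group elements; the arbitrary values outside
      the carrier enter neither the matrix nor the distribution conditions.\<close>
    define p where "p h = \<mu> (inv_into {..<order G} g h)" for h
    have p: "p (g r) = \<mu> r" if "r < order G" for r
      using that bij_betw_inv_into_left[OF enum] by (simp add: p_def)
    have "Q = transition_mat G g p"
      unfolding Q *[symmetric] by (intro eq_matI) (auto simp: p)
    moreover have "distribution_on (carrier G) p"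
      unfolding dist using \<mu> p by simp
    ultimately show "Q \<in> {transition_mat G g p | p. distribution_on (carrier G) p}" by blast
  next
    fix Q assume "Q \<in> {transition_mat G g p | p. distribution_on (carrier G) p}"
    then obtain p where "distribution_on (carrier G) p" "Q = transition_mat G g p" by blast
    then show "Q \<in> birkhoff_subpolytope G g"
      unfolding birkhoff_subpolytope_def dist *[symmetric]
      by (intro CollectI exI[of _ "\<lambda>r. p (g r)"]) simp
  qed
qed

text \<open>For distributions \<open>p\<close> and \<open>p'\<close>, this is the law of the product
  of two independent random group elements with these laws, in that order.\<close>

definition convolution :: "('a \<Rightarrow> real) \<Rightarrow> ('a \<Rightarrow> real) \<Rightarrow> 'a \<Rightarrow> real" where
  "convolution p p' k = (\<Sum>h\<in>carrier G. p h * p' (inv h \<otimes> k))"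

lemma sum_translate:
  "h \<in> carrier G \<Longrightarrow> (\<Sum>k\<in>carrier G. f (inv h \<otimes> k)) = (\<Sum>k\<in>carrier G. (f k :: real))"
  by (rule sum.reindex_bij_witness[of _ "\<lambda>k. h \<otimes> k" "\<lambda>k. inv h \<otimes> k"])
    (auto simp: m_assoc[symmetric])

lemma distribution_on_convolution:
  assumes p: "distribution_on (carrier G) p" and p': "distribution_on (carrier G) p'"
  shows "distribution_on (carrier G) (convolution p p')"
proof -
  have "(\<Sum>k\<in>carrier G. convolution p p' k)
      = (\<Sum>h\<in>carrier G. p h * (\<Sum>k\<in>carrier G. p' (inv h \<otimes> k)))"
    unfolding convolution_def by (subst sum.swap) (simp add: sum_distrib_left)
  also have "\<dots> = 1"
    using p p' by (simp add: sum_translate distribution_on_def)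
  finally show ?thesis
    using p p' by (auto simp: distribution_on_def convolution_def intro!: sum_nonneg)
qed

text \<open>The matrix product sums over the intermediate state \<open>k\<close>; measured as the
  increment \<open>inv (g a) \<otimes> k\<close> from the start, it becomes the summation variable
  of the convolution.\<close>

lemma transition_mat_convolution:
  "transition_mat G g p * transition_mat G g p' = transition_mat G g (convolution p p')"
proof (rule eq_matI)
  fix a b
  assume "a < dim_row (transition_mat G g (convolution p p'))"
    and "b < dim_col (transition_mat G g (convolution p p'))"
  then have ab: "a < order G" "b < order G" by (auto simp: transition_mat_def)
  have "(transition_mat G g p * transition_mat G g p') $$ (a, b)
      = (\<Sum>c<order G. p (inv (g a) \<otimes> g c) * p' (inv (g c) \<otimes> g b))"
    using ab by (simp add: transition_mat_def scalar_prod_def lessThan_atLeast0)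
  also have "\<dots> = (\<Sum>k\<in>carrier G. p (inv (g a) \<otimes> k) * p' (inv k \<otimes> g b))"
    by (rule sum.reindex_bij_betw[OF enum])
  \<comment> \<open>Inserting \<open>g a\<close> and its inverse makes the summand depend on
    \<open>k\<close> only through \<open>inv (g a) \<otimes> k\<close>, the form that
    \<open>sum_translate\<close> needs.\<close>
  also have "\<dots> = (\<Sum>k\<in>carrier G. p (inv (g a) \<otimes> k) * p' (inv (inv (g a) \<otimes> k) \<otimes> (inv (g a) \<otimes> g b)))"
  proof (rule sum.cong[OF refl])
    fix k assume k: "k \<in> carrier G"
    have "inv (inv (g a) \<otimes> k) \<otimes> (inv (g a) \<otimes> g b) = inv k \<otimes> g b"
      using k ab by (simp add: inv_mult_group m_assoc[symmetric]) (simp add: m_assoc)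
    then show "p (inv (g a) \<otimes> k) * p' (inv k \<otimes> g b)
        = p (inv (g a) \<otimes> k) * p' (inv (inv (g a) \<otimes> k) \<otimes> (inv (g a) \<otimes> g b))" by simp
  qed
  also have "\<dots> = convolution p p' (inv (g a) \<otimes> g b)"
    unfolding convolution_def
    using sum_translate[of "g a" "\<lambda>h. p h * p' (inv h \<otimes> (inv (g a) \<otimes> g b))"] ab by simp
  finally show "(transition_mat G g p * transition_mat G g p') $$ (a, b)
      = transition_mat G g (convolution p p') $$ (a, b)"
    using ab by (simp add: transition_mat_def)
qed (auto simp: transition_mat_def)

section \<open>The subpolytope as a monoid acting on vectors\<close>

lemma birkhoff_subpolytope_carrier:
  "Q \<in> birkhoff_subpolytope G g \<Longrightarrow> Q \<in> carrier_mat (order G) (order G)"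
  by (auto simp: birkhoff_subpolytope_eq_transition_mats)

lemma birkhoff_subpolytope_mult:
  assumes "Q \<in> birkhoff_subpolytope G g" "R \<in> birkhoff_subpolytope G g"
  shows "Q * R \<in> birkhoff_subpolytope G g"
  using assms distribution_on_convolution transition_mat_convolution
  unfolding birkhoff_subpolytope_eq_transition_mats by blast

text \<open>The identity is the transition matrix of the point mass at \<open>\<one>\<close>. It
  starts the induction on powers and covers the case \<open>n = k\<close> of the theorem.\<close>

lemma one_in_birkhoff_subpolytope: "1\<^sub>m (order G) \<in> birkhoff_subpolytope G g"
proof -
  let ?\<delta> = "\<lambda>h. if h = \<one> then 1 else 0 :: real"
  have "inv (g a) \<otimes> g b = \<one> \<longleftrightarrow> a = b" if ab: "a < order G" "b < order G" for a b
  proof -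
    have "inv (g a) \<otimes> g b = \<one> \<longleftrightarrow> g a = g b"
      using ab by (metis enum_closed inv_closed inv_equality inv_inv l_inv)
    also have "\<dots> \<longleftrightarrow> a = b"
      using ab enum by (auto simp: bij_betw_def inj_on_def)
    finally show ?thesis .
  qed
  then have "1\<^sub>m (order G) = transition_mat G g ?\<delta>"
    by (intro eq_matI) (auto simp: transition_mat_def)
  moreover have "distribution_on (carrier G) ?\<delta>"
    using finite_carrier by (simp add: distribution_on_def)
  ultimately show ?thesis
    unfolding birkhoff_subpolytope_eq_transition_mats by blast
qed

lemma birkhoff_subpolytope_pow:
  assumes "Q \<in> birkhoff_subpolytope G g"
  shows "Q ^\<^sub>m n \<in> birkhoff_subpolytope G g"
  using birkhoff_subpolytope_carrier[OF assms]
  by (induction n) (auto intro: birkhoff_subpolytope_mult assms one_in_birkhoff_subpolytope)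

text \<open>A further step \<open>R\<close> after \<open>Q\<close> is the single step
  \<open>Q * R\<close>, again in the subpolytope.\<close>

lemma vec_polytope_mult_subset:
  assumes x: "x \<in> carrier_vec (order G)" and Q: "Q \<in> birkhoff_subpolytope G g"
  shows "vec_polytope (x \<^sub>v* Q) (birkhoff_subpolytope G g) \<subseteq> vec_polytope x (birkhoff_subpolytope G g)"
proof
  fix y assume "y \<in> vec_polytope (x \<^sub>v* Q) (birkhoff_subpolytope G g)"
  then obtain R where R: "R \<in> birkhoff_subpolytope G g" and y: "y = x \<^sub>v* Q \<^sub>v* R"
    unfolding vec_polytope_def by blast
  have "y = x \<^sub>v* (Q * R)"
    using vec_mult_mat_assoc[OF x] birkhoff_subpolytope_carrier Q R y by metis
  then show "y \<in> vec_polytope x (birkhoff_subpolytope G g)"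
    using birkhoff_subpolytope_mult[OF Q R] unfolding vec_polytope_def by blast
qed

end

section \<open>The random walk\<close>

lemma pow_mat_add:
  assumes "A \<in> carrier_mat n n"
  shows "A ^\<^sub>m (i + j) = A ^\<^sub>m i * A ^\<^sub>m j"
  using assms
  by (induction j) (auto simp: assoc_mult_mat[of _ n n _ n _ n] pow_carrier_mat)

theorem propositionV2:
  fixes G :: "('a, 'c) monoid_scheme"
    and g :: "nat \<Rightarrow> 'a"
    and p :: "'a \<Rightarrow> real"
    and P :: "real mat"
    and q :: "nat \<Rightarrow> real vec"
  assumes "comm_group G"
    and "finite (carrier G)"
    and "bij_betw g {..<order G} (carrier G)"
    and "\<And>h. h \<in> carrier G \<Longrightarrow> 0 \<le> p h"
    and "(\<Sum>h\<in>carrier G. p h) = 1"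
    and "P = transition_mat G g p"
    and "prob_vec (order G) (q 0)"
    and "\<And>n. q n = q 0 \<^sub>v* (P ^\<^sub>m n)"
  shows "(\<forall>k. \<forall>n\<ge>k. q n \<in> vec_polytope (q k) (birkhoff_subpolytope G g)) \<and>
    (\<forall>n. q n \<succ>\<^sub>m q (Suc n)) \<and>
    (\<forall>n. vec_entropy (q n) \<le> vec_entropy (q (Suc n))) \<and>
    (\<forall>n. gini (q n) \<ge> gini (q (Suc n))) \<and>
    (\<forall>n. vec_polytope (q n) (birkhoff_subpolytope G g)
        \<supseteq> vec_polytope (q (Suc n)) (birkhoff_subpolytope G g))"
proof -
  interpret comm_group G by fact
  interpret enumerated_group G g
    by unfold_locales (use assms(2,3) in simp_all)
  have P: "P \<in> birkhoff_subpolytope G g"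
    using assms(4-6) unfolding birkhoff_subpolytope_eq_transition_mats distribution_on_def by blast
  have ds: "doubly_stochastic (order G) P"
    unfolding assms(6)
    by (rule transition_mat_doubly_stochastic[OF is_group assms(2-5)])
  have Pc: "P \<in> carrier_mat (order G) (order G)"
    by (rule birkhoff_subpolytope_carrier[OF P])
  have q0: "q 0 \<in> carrier_vec (order G)"
    using assms(7) by (simp add: prob_vec_def)
  \<comment> \<open>The walk restarted at time \<open>k\<close>: \<open>j = n - k\<close> serves the
    polytope membership, and \<open>j = 1\<close> all statements about consecutive times.\<close>
  have q_add: "q (k + j) = q k \<^sub>v* (P ^\<^sub>m j)" for k j
    unfolding assms(8)[of "k + j"] assms(8)[of k] pow_mat_add[OF Pc]
    by (rule vec_mult_mat_assoc[OF q0 pow_carrier_mat[OF Pc] pow_carrier_mat[OF Pc]])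
  have q_Suc: "q (Suc n) = q n \<^sub>v* P" for n
    using q_add[of n 1] Pc by simp
  \<comment> \<open>Supplies the nonnegative entries that the entropy inequality requires at every
    time.\<close>
  have prob: "prob_vec (order G) (q n)" for n
    by (induction n) (auto simp: q_Suc assms(7) intro: prob_vec_mult ds)
  have qc: "q n \<in> carrier_vec (order G)" and q_nonneg: "\<And>a. a < order G \<Longrightarrow> 0 \<le> q n $ a" for n
    using prob[of n] by (auto simp: prob_vec_def)
  \<comment> \<open>The matrix that witnesses membership is
    \<open>P ^\<^sub>m (n - k)\<close>.\<close>
  have "q n \<in> vec_polytope (q k) (birkhoff_subpolytope G g)" if "k \<le> n" for k n
    using that q_add[of k "n - k"] birkhoff_subpolytope_pow[OF P, of "n - k"]
    by (auto simp: vec_polytope_def)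
  moreover have maj: "q n \<succ>\<^sub>m q (Suc n)" for n
    unfolding q_Suc by (rule doubly_stochastic_majorizes[OF qc ds])
  moreover have "vec_entropy (q n) \<le> vec_entropy (q (Suc n))" for n
    unfolding q_Suc by (rule doubly_stochastic_entropy_le[OF qc q_nonneg ds])
  moreover have "gini (q (Suc n)) \<le> gini (q n)" for n
    by (rule majorizes_imp_gini_le[OF maj])
  moreover have "vec_polytope (q (Suc n)) (birkhoff_subpolytope G g)
      \<subseteq> vec_polytope (q n) (birkhoff_subpolytope G g)" for n
    unfolding q_Suc by (rule vec_polytope_mult_subset[OF qc P])
  ultimately show ?thesis by blast
qed

end
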